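(* Let $G$ be a simple game and $G^*$ its dual. Then $f(G)=f(G^* )$ and $g(G)=g(G^* )$.
   Context: A simple game is $G=(P,W)$ with $P$ finite, $W\subseteq 2^P$ (winning coalitions) closed under supersets within $P$, $W\ne\emptyset$, $W\ne 2^P$; $L=2^P\setminus W$ is the set of losing coalitions. The dual game is $G^*=(P,\{P\setminus Y: Y\in L\})$, i.e. its winning coalitions are exactly the complements of losing coalitions of $G$. A trading transform of length $j$ is $(X_1,\dots,X_j;Y_1,\dots,Y_j)$ with every player in equally many $X_i$'s and $Y_i$'s; a certificate of non-weightedness has all $X_i$ winning and all $Y_i$ losing; it is potent if $P$ is among the $X_i$ and $\emptyset$ among the $Y_i$. $f(G)$ is the least length of a certificate of non-weightedness for $G$ (equivalently the least $k$ such that $G$ is not $k$-trade robust), $f(G)=\infty$ if none exists; $g(G)$ is the least length of a potent certificate of non-weightedness, $g(G)=\infty$ if none exists. *)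

theory Defs
  imports "HOL-Library.Extended_Nat"
begin

type_synonym 'a game = "'a set \<times> 'a set set"

definition players :: "'a game \<Rightarrow> 'a set" where
  "players G = fst G"

definition winning :: "'a game \<Rightarrow> 'a set set" where
  "winning G = snd G"

definition losing :: "'a game \<Rightarrow> 'a set set" where
  "losing G = Pow (players G) - winning G"

definition simple_game :: "'a game \<Rightarrow> bool" where
  "simple_game G \<longleftrightarrow>
     finite (players G) \<and>
     winning G \<subseteq> Pow (players G) \<and>
     (\<forall>X \<in> winning G. \<forall>Z. X \<subseteq> Z \<and> Z \<subseteq> players G \<longrightarrow> Z \<in> winning G) \<and>
     winning G \<noteq> {} \<and>
     winning G \<noteq> Pow (players G)"

definition dual_game :: "'a game \<Rightarrow> 'a game" where
  "dual_game G = (players G, {players G - Y | Y. Y \<in> losing G})"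

text \<open>
  The two halves of a trading transform are lists of coalitions, so repetitions are allowed.
  The length is required to be positive: the empty transform would vacuously be a certificate
  of non-weightedness for every game.
\<close>

definition trading_transform :: "'a game \<Rightarrow> 'a set list \<Rightarrow> 'a set list \<Rightarrow> bool" where
  "trading_transform G Xs Ys \<longleftrightarrow>
     length Xs = length Ys \<and> 0 < length Xs \<and>
     set Xs \<subseteq> Pow (players G) \<and> set Ys \<subseteq> Pow (players G) \<and>
     (\<forall>p \<in> players G. card {i. i < length Xs \<and> p \<in> Xs ! i} = card {i. i < length Ys \<and> p \<in> Ys ! i})"

definition certificate :: "'a game \<Rightarrow> 'a set list \<Rightarrow> 'a set list \<Rightarrow> bool" where
  "certificate G Xs Ys \<longleftrightarrow>
     trading_transform G Xs Ys \<and> set Xs \<subseteq> winning G \<and> set Ys \<subseteq> losing G"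

definition potent_certificate :: "'a game \<Rightarrow> 'a set list \<Rightarrow> 'a set list \<Rightarrow> bool" where
  "potent_certificate G Xs Ys \<longleftrightarrow>
     certificate G Xs Ys \<and> players G \<in> set Xs \<and> {} \<in> set Ys"

text \<open>In \<^typ>\<open>enat\<close> the infimum of the empty set is \<open>\<infinity>\<close>, and that of a nonempty set is its
  least element.\<close>

definition f_game :: "'a game \<Rightarrow> enat" where
  "f_game G = Inf {enat (length Xs) | Xs Ys. certificate G Xs Ys}"

definition g_game :: "'a game \<Rightarrow> enat" where
  "g_game G = Inf {enat (length Xs) | Xs Ys. potent_certificate G Xs Ys}"

end

theory Submission
  imports Defs
begin

text \<open>
  Complementing every coalition and exchanging the two halves turns a certificate for \<open>G\<close> into
  one of the same length for the dual game: a player lying in \<open>m\<close> of the \<open>j\<close> coalitions of each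
  half lies in \<open>j - m\<close> of the complements. Potency is preserved because the grand and the empty
  coalition are complementary. As the dual of the dual is \<open>G\<close>, both minima agree.
\<close>

lemma players_dual_game [simp]: "players (dual_game G) = players G"
  by (simp add: dual_game_def players_def)

lemma winning_dual_game: "winning (dual_game G) = (\<lambda>Y. players G - Y) ` losing G"
  by (auto simp: dual_game_def winning_def)

text \<open>Complementation is injective on subsets of the player set, so the complement of a
  winning coalition is never that of a losing one. The assumption puts the winning coalitions where
  this injectivity applies.\<close>

lemma losing_dual_game:
  assumes "winning G \<subseteq> Pow (players G)"
  shows "losing (dual_game G) = (\<lambda>X. players G - X) ` winning G"
proof (intro equalityI subsetI)
  fix Z assume "Z \<in> losing (dual_game G)"
  then have Z: "Z \<subseteq> players G" "Z \<notin> (\<lambda>Y. players G - Y) ` losing G"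
    by (simp_all add: losing_def winning_dual_game)
  then have "Z = players G - (players G - Z)"
    by (simp add: double_diff)
  \<comment> \<open>Were \<open>players G - Z\<close> losing, its complement \<open>Z\<close> would
    be winning in the dual.\<close>
  moreover from this Z have "players G - Z \<in> winning G"
    by (auto simp: losing_def)
  ultimately show "Z \<in> (\<lambda>X. players G - X) ` winning G"
    by blast
next
  fix Z assume "Z \<in> (\<lambda>X. players G - X) ` winning G"
  then obtain X where X: "X \<in> winning G" "Z = players G - X" by blast
  have "players G - X \<noteq> players G - Y" if "Y \<in> losing G" for Y
  proof
    assume "players G - X = players G - Y"
    moreover have "X \<subseteq> players G" "Y \<subseteq> players G"
      using X that assms by (auto simp: losing_def)
    ultimately have "X = Y" by blast
    with X that show False by (simp add: losing_def)
  qed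
  with X show "Z \<in> losing (dual_game G)"
    by (auto simp: losing_def [of "dual_game G"] winning_dual_game)
qed

lemma dual_game_dual_game:
  assumes "winning G \<subseteq> Pow (players G)"
  shows "dual_game (dual_game G) = G"
proof -
  have "winning (dual_game (dual_game G)) = (\<lambda>X. players G - (players G - X)) ` winning G"
    using assms by (simp add: winning_dual_game [of "dual_game G"] losing_dual_game image_image)
  also have "\<dots> = (\<lambda>X. X) ` winning G"
    using assms by (intro image_cong) auto
  finally have "winning (dual_game (dual_game G)) = winning G" by simp
  moreover have "players (dual_game (dual_game G)) = players G" by simp
  \<comment> \<open>A game is a pair with projections \<open>players\<close> and
    \<open>winning\<close>; \<open>rotated\<close> matches the order of the chained facts, second
    component first.\<close>
  ultimately show ?thesis
    unfolding winning_def players_def by (rule prod_eqI [rotated])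
qed

text \<open>Since \<open>p\<close> lies in \<open>P\<close>, complementing moves it into exactly
  those positions where it was absent.\<close>

lemma card_indices_complement:
  assumes "p \<in> P"
  shows "card {i. i < length Xs \<and> p \<in> map (\<lambda>X. P - X) Xs ! i} =
    length Xs - card {i. i < length Xs \<and> p \<in> Xs ! i}"
proof -
  have "{i. i < length Xs \<and> p \<in> map (\<lambda>X. P - X) Xs ! i} =
      {..<length Xs} - {i. i < length Xs \<and> p \<in> Xs ! i}"
    using assms by auto
  also have "card \<dots> = length Xs - card {i. i < length Xs \<and> p \<in> Xs ! i}"
    by (subst card_Diff_subset) auto
  finally show ?thesis .
qed

text \<open>Equal counts subtracted from the common length stay equal. The halves are exchanged so
  that complements of losing coalitions, winning in the dual, come first.\<close>

lemma trading_transform_complement: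
  assumes "trading_transform G Xs Ys"
  shows "trading_transform G (map (\<lambda>Y. players G - Y) Ys) (map (\<lambda>X. players G - X) Xs)"
  unfolding trading_transform_def length_map
proof (intro conjI ballI)
  fix p assume p: "p \<in> players G"
  show "card {i. i < length Ys \<and> p \<in> map (\<lambda>Y. players G - Y) Ys ! i} =
      card {i. i < length Xs \<and> p \<in> map (\<lambda>X. players G - X) Xs ! i}"
    unfolding card_indices_complement [OF p]
    using assms p unfolding trading_transform_def by metis
qed (use assms in \<open>auto simp: trading_transform_def\<close>)

lemma certificate_dual_game:
  assumes "winning G \<subseteq> Pow (players G)" "certificate G Xs Ys"
  shows "certificate (dual_game G)
    (map (\<lambda>Y. players G - Y) Ys) (map (\<lambda>X. players G - X) Xs)"
proof -
  \<comment> \<open>A trading transform depends on the game only through its player set, which the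
    dual shares.\<close>
  have "trading_transform (dual_game G) = trading_transform G"
    by (simp add: trading_transform_def fun_eq_iff)
  with assms trading_transform_complement [of G Xs Ys] show ?thesis
    by (auto simp: certificate_def winning_dual_game losing_dual_game)
qed

lemma potent_certificate_dual_game:
  assumes "winning G \<subseteq> Pow (players G)" "potent_certificate G Xs Ys"
  shows "potent_certificate (dual_game G)
    (map (\<lambda>Y. players G - Y) Ys) (map (\<lambda>X. players G - X) Xs)"
  using assms certificate_dual_game [of G Xs Ys]
  by (force simp: potent_certificate_def)

text \<open>Each certificate length for \<open>G\<close> is also one for the dual, and an infimum
  over a superset is no larger. The value \<infinity> needs no separate case.\<close>

lemma f_game_dual_game_le:
  assumes "winning G \<subseteq> Pow (players G)"
  shows "f_game (dual_game G) \<le> f_game G"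
  unfolding f_game_def
proof (rule Inf_superset_mono, clarify)
  fix Xs Ys assume "certificate G Xs Ys"
  then have "certificate (dual_game G)
      (map (\<lambda>Y. players G - Y) Ys) (map (\<lambda>X. players G - X) Xs)"
    \<comment> \<open>The new first half is built from \<open>Ys\<close>, so the equal lengths of
      the two halves enter here.\<close>
    and "length Xs = length (map (\<lambda>Y. players G - Y) Ys)"
    using certificate_dual_game [OF assms]
    by (simp_all add: certificate_def trading_transform_def)
  then show "\<exists>Xs' Ys'. enat (length Xs) = enat (length Xs') \<and> certificate (dual_game G) Xs' Ys'"
    by blast
qed

lemma g_game_dual_game_le:
  assumes "winning G \<subseteq> Pow (players G)"
  shows "g_game (dual_game G) \<le> g_game G"
  unfolding g_game_def
proof (rule Inf_superset_mono, clarify)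
  fix Xs Ys assume "potent_certificate G Xs Ys"
  then have "potent_certificate (dual_game G)
      (map (\<lambda>Y. players G - Y) Ys) (map (\<lambda>X. players G - X) Xs)"
    and "length Xs = length (map (\<lambda>Y. players G - Y) Ys)"
    using potent_certificate_dual_game [OF assms]
    by (simp_all add: potent_certificate_def certificate_def trading_transform_def)
  then show "\<exists>Xs' Ys'. enat (length Xs) = enat (length Xs') \<and>
      potent_certificate (dual_game G) Xs' Ys'"
    by blast
qed

theorem theorem14:
  fixes G :: "'a game"
  assumes "simple_game G"
  shows "f_game G = f_game (dual_game G) \<and> g_game G = g_game (dual_game G)"
proof -
  have G: "winning G \<subseteq> Pow (players G)"
    using assms by (simp add: simple_game_def)
  \<comment> \<open>Complements lie in the player set by construction, so both bounds also apply to
    the dual; cancelling the double dual there yields the reverse inequalities.\<close>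
  have dual: "winning (dual_game G) \<subseteq> Pow (players (dual_game G))"
    by (auto simp: winning_dual_game)
  show ?thesis
    using f_game_dual_game_le [OF G] f_game_dual_game_le [OF dual]
      g_game_dual_game_le [OF G] g_game_dual_game_le [OF dual]
    by (simp add: dual_game_dual_game [OF G] order.antisym)
qed

end
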